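(* Let $L\colon A\to\mathbb{R}$ be a linear functional with $L(1)=1$ that is represented by a Radon measure $\nu_L$ on $X(A)$ with compact support $K$. If for each $\alpha\in K$ there exist $C_\alpha\in(0,1]$ and $d_\alpha\in\mathbb{N}$ such that $C_\alpha\, p_L(a)\le p_{d_\alpha}(a)$ for all $a\in[\alpha]_K$, then $K$ is countable.
   Context: $A$ is a unital commutative $\mathbb{R}$-algebra whose character space $X(A)$ (the set of all (unital) $\mathbb{R}$-algebra homomorphisms $A\to\mathbb{R}$) is non-empty; $X(A)$ carries the weakest topology making all $\hat a\colon X(A)\to\mathbb{R}$, $\hat a(\alpha)=\alpha(a)$, $a\in A$, continuous. A Radon measure on $X(A)$ is a non-negative Borel measure that is locally finite and inner regular w.r.t. compact sets; its support is the smallest closed set with complement of measure zero. $L$ is represented by $\nu_L$ if $L(a)=\int\hat a\,\mathrm{d}\nu_L$ for all $a\in A$. Notation: $\mathbb{N}=\{1,2,\dots\}$; $p_d(a):=\sqrt[2^d]{L(a^{2^d})}$ for $d\in\mathbb{N}$, $a\in A$; $p_L(a):=\sup_{n\in\mathbb{N}}\sqrt[2n]{L(a^{2n})}$ (finite here). $\|a\|_K:=\max_{\beta\in K}|\beta(a)|$ and, for $\alpha\in K$, $[\alpha]_K:=\{a\in A:\|a\|_K=|\alpha(a)|\}$. *)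

theory Defs
  imports "HOL-Analysis.Analysis"
begin

section \<open>The character space\<close>

text \<open>A unital commutative real algebra is a type of sort
  \<open>{real_algebra_1, comm_ring_1}\<close>.\<close>

definition character_space :: "('a::{real_algebra_1,comm_ring_1} \<Rightarrow> real) set" where
  "character_space =
     {\<alpha>. linear \<alpha> \<and> (\<forall>a b. \<alpha> (a * b) = \<alpha> a * \<alpha> b) \<and> \<alpha> 1 = 1}"

definition character_topology :: "('a::{real_algebra_1,comm_ring_1} \<Rightarrow> real) topology" where
  "character_topology =
     topology_generated_by {{\<alpha> \<in> character_space. \<alpha> a \<in> U} | a U. open U}"

lemma topspace_character_topology [simp]: "topspace character_topology = character_space"
  unfolding character_topology_def by auto

lemma continuous_map_evaluation:
  "continuous_map character_topology euclideanreal (\<lambda>\<alpha>. \<alpha> a)"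
proof -
  have "openin character_topology {\<alpha> \<in> character_space. \<alpha> a \<in> U}" if "open U" for U
    unfolding character_topology_def by (rule topology_generated_by_Basis) (use that in blast)
  then show ?thesis by (simp add: continuous_map_def)
qed

lemma character_topology_weakest:
  assumes "topspace T = character_space"
    and "\<And>a. continuous_map T euclideanreal (\<lambda>\<alpha>. \<alpha> a)"
    and "openin character_topology S"
  shows "openin T S"
proof -
  have "generate_topology_on {{\<alpha> \<in> character_space. \<alpha> a \<in> U} | a U. open U} S"
    using assms(3) unfolding character_topology_def openin_topology_generated_by_iff .
  then show ?thesis
  proof induction
    case (Basis s)
    then show ?case using assms(1,2) by (auto simp: continuous_map_def)
  next
    case (UN K)
    then show ?case by (intro openin_Union) auto
  qed auto
qed

section \<open>Radon measures on a topological space\<close>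

definition radon_measure :: "'b topology \<Rightarrow> 'b measure \<Rightarrow> bool" where
  "radon_measure T M \<longleftrightarrow>
     space M = topspace T \<and>
     sets M = sigma_sets (topspace T) {U. openin T U} \<and>
     (\<forall>x\<in>topspace T. \<exists>U. openin T U \<and> x \<in> U \<and> emeasure M U < \<infinity>) \<and>
     (\<forall>B\<in>sets M. emeasure M B = (SUP C\<in>{C. compactin T C \<and> C \<in> sets M \<and> C \<subseteq> B}. emeasure M C))"

definition is_measure_support :: "'b topology \<Rightarrow> 'b measure \<Rightarrow> 'b set \<Rightarrow> bool" where
  "is_measure_support T M K \<longleftrightarrow>
     closedin T K \<and> emeasure M (topspace T - K) = 0 \<and>
     (\<forall>C. closedin T C \<and> emeasure M (topspace T - C) = 0 \<longrightarrow> K \<subseteq> C)"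

text \<open>Integrability is part of the definition because the Bochner integral of a
  non-integrable function is \<open>0\<close>.\<close>

definition represented_by ::
  "('a::{real_algebra_1,comm_ring_1} \<Rightarrow> real) \<Rightarrow> ('a \<Rightarrow> real) measure \<Rightarrow> bool" where
  "represented_by L M \<longleftrightarrow>
     (\<forall>a. integrable M (\<lambda>\<alpha>. \<alpha> a) \<and> L a = (\<integral>\<alpha>. \<alpha> a \<partial>M))"

section \<open>Seminorms\<close>

definition p_dyadic ::
  "('a::{real_algebra_1,comm_ring_1} \<Rightarrow> real) \<Rightarrow> nat \<Rightarrow> 'a \<Rightarrow> real" where
  "p_dyadic L d a = root (2 ^ d) (L (a ^ (2 ^ d)))"

text \<open>The suprema below are taken in the reals, so they are meaningful only for non-empty
  families that are bounded above. For \<open>p_sup\<close> this holds when \<open>L\<close> is represented by a Radon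
  measure with compact support; in \<open>sup_on\<close> the supremum is the maximum when \<open>K\<close> is non-empty
  and compact.\<close>

definition p_sup :: "('a::{real_algebra_1,comm_ring_1} \<Rightarrow> real) \<Rightarrow> 'a \<Rightarrow> real" where
  "p_sup L a = (SUP n\<in>{1::nat..}. root (2 * n) (L (a ^ (2 * n))))"

definition sup_on :: "('a::{real_algebra_1,comm_ring_1} \<Rightarrow> real) set \<Rightarrow> 'a \<Rightarrow> real" where
  "sup_on K a = (SUP \<beta>\<in>K. \<bar>\<beta> a\<bar>)"

definition peak_set ::
  "('a::{real_algebra_1,comm_ring_1} \<Rightarrow> real) set \<Rightarrow> ('a \<Rightarrow> real) \<Rightarrow> 'a set" where
  "peak_set K \<alpha> = {a. sup_on K a = \<bar>\<alpha> a\<bar>}"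

end

theory Submission
  imports Defs "HOL-Probability.Probability_Measure"
begin

text \<open>
  Every point \<open>\<alpha>\<close> of \<open>K\<close> is an atom of \<open>\<nu>\<close>, and a probability measure has only countably many
  atoms. Given an open neighbourhood \<open>U\<close> of \<open>\<alpha>\<close>, subtracting from \<open>1\<close> a small multiple of a sum of
  squares \<open>(x - \<alpha> x)\<^sup>2\<close> gives an element \<open>a\<close> with \<open>0 \<le> a \<le> 1\<close> on \<open>K\<close>, \<open>\<alpha> a = 1\<close>, and
  \<open>a \<le> r < 1\<close> on \<open>K - U\<close>. Its powers lie in \<open>[\<alpha>]\<^sub>K\<close> and satisfy \<open>p\<^sub>L (a\<^sup>n) = 1\<close>, so the hypothesis
  yields \<open>C\<^bsup>2^d\<^esup> \<le> \<integral> a\<^bsup>n 2^d\<^esup> d\<nu> \<le> \<nu> U + r\<^bsup>n 2^d\<^esup>\<close>. Letting \<open>n\<close> tend to infinity bounds \<open>\<nu> U\<close>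
  below independently of \<open>U\<close>, and inner regularity transfers the bound to \<open>{\<alpha>}\<close>.
\<close>

section \<open>Characters and the topology of pointwise convergence\<close>

lemma character_linear: "\<beta> \<in> character_space \<Longrightarrow> linear \<beta>"
  by (simp add: character_space_def)

lemma character_one: "\<beta> \<in> character_space \<Longrightarrow> \<beta> 1 = 1"
  by (simp add: character_space_def)

lemma character_mult: "\<beta> \<in> character_space \<Longrightarrow> \<beta> (a * b) = \<beta> a * \<beta> b"
  by (simp add: character_space_def)

lemma character_power: "\<beta> \<in> character_space \<Longrightarrow> \<beta> (a ^ n) = \<beta> a ^ n"
  by (induction n) (simp_all add: character_one character_mult)

text \<open>Induction over how the open set is generated: a finite intersection merges the two
  finite sets and takes the smaller tolerance. Finiteness of \<open>F\<close> is what later allows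
  its deviations to be collected in a single element of the algebra.\<close>

lemma character_neighbourhood_basis:
  fixes \<alpha> :: "'a::{real_algebra_1,comm_ring_1} \<Rightarrow> real"
  assumes "openin character_topology U" "\<alpha> \<in> U"
  shows "\<exists>F \<epsilon>. finite F \<and> 0 < \<epsilon> \<and> {\<beta> \<in> character_space. \<forall>a\<in>F. \<bar>\<beta> a - \<alpha> a\<bar> < \<epsilon>} \<subseteq> U"
proof -
  have "generate_topology_on {{\<alpha> \<in> character_space. \<alpha> a \<in> U} | a U. open U} U"
    using assms(1) unfolding character_topology_def openin_topology_generated_by_iff .
  then show ?thesis using assms(2)
  proof induction
    case (Int S T)
    have "\<alpha> \<in> S" "\<alpha> \<in> T" using Int.prems by auto
    from Int.IH(1)[OF this(1)] Int.IH(2)[OF this(2)] obtain F \<epsilon> G \<delta> where *: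
      "finite F" "0 < \<epsilon>" "{\<beta> \<in> character_space. \<forall>a\<in>F. \<bar>\<beta> a - \<alpha> a\<bar> < \<epsilon>} \<subseteq> S"
      "finite G" "0 < \<delta>" "{\<beta> \<in> character_space. \<forall>a\<in>G. \<bar>\<beta> a - \<alpha> a\<bar> < \<delta>} \<subseteq> T"
      by (elim exE conjE)
    show ?case
      by (rule exI[of _ "F \<union> G"], rule exI[of _ "min \<epsilon> \<delta>"]) (use * in auto)
  next
    case (UN S)
    then obtain T where T: "T \<in> S" "\<alpha> \<in> T" by blast
    from UN.IH[OF T] T(1) show ?case by (meson Union_upper order_trans)
  next
    case (Basis s)
    then obtain a U where s: "s = {\<alpha> \<in> character_space. \<alpha> a \<in> U}" "open U" "\<alpha> a \<in> U" by blast
    then obtain \<epsilon> where \<epsilon>: "\<epsilon> > 0" "\<forall>y. dist y (\<alpha> a) < \<epsilon> \<longrightarrow> y \<in> U" by (metis open_dist)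
    show ?case
      by (rule exI[of _ "{a}"], rule exI[of _ \<epsilon>]) (use \<epsilon> s in \<open>auto simp: dist_real_def\<close>)
  qed auto
qed

text \<open>Distinct characters differ at some element, and evaluation there pulls separating open
  sets of reals back. This makes points and compact sets closed, as
  \<open>radon_measure_singleton_ge\<close> requires.\<close>

lemma Hausdorff_character_topology:
  "Hausdorff_space (character_topology :: ('a::{real_algebra_1,comm_ring_1} \<Rightarrow> real) topology)"
  unfolding Hausdorff_space_def
proof (intro allI impI)
  fix \<alpha> \<beta> :: "'a \<Rightarrow> real"
  assume *: "\<alpha> \<in> topspace character_topology \<and> \<beta> \<in> topspace character_topology \<and> \<alpha> \<noteq> \<beta>"
  then obtain a where "\<alpha> a \<noteq> \<beta> a" by blast
  then obtain U V where UV: "open U" "open V" "\<alpha> a \<in> U" "\<beta> a \<in> V" "U \<inter> V = {}"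
    by (meson hausdorff)
  have pre: "openin character_topology {\<gamma> \<in> character_space. \<gamma> a \<in> W}" if "open W" for W
    using openin_continuous_map_preimage[OF continuous_map_evaluation[of a]] that by simp
  show "\<exists>U V. openin character_topology U \<and> openin character_topology V
      \<and> \<alpha> \<in> U \<and> \<beta> \<in> V \<and> disjnt U V"
    by (intro exI[of _ "{\<gamma> \<in> character_space. \<gamma> a \<in> U}"]
        exI[of _ "{\<gamma> \<in> character_space. \<gamma> a \<in> V}"]) (use UV * pre in \<open>auto simp: disjnt_def\<close>)
qed

text \<open>The sum of squares \<open>b\<close> vanishes at \<alpha>, is bounded on \<open>K\<close>
  by compactness, and is at least \<open>\<epsilon>^2\<close> off \<open>U\<close>, where some
  member of \<open>F\<close> deviates by \<epsilon> or more. Rescaling and subtracting from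
  \<open>1\<close> turns this zero into a peak.\<close>

lemma exists_peaking_element:
  fixes \<alpha> :: "'a::{real_algebra_1,comm_ring_1} \<Rightarrow> real"
  assumes K: "compactin character_topology K" and \<alpha>: "\<alpha> \<in> K"
    and U: "openin character_topology U" "\<alpha> \<in> U"
  shows "\<exists>a r. 0 \<le> r \<and> r < 1 \<and> \<alpha> a = 1 \<and> (\<forall>\<beta>\<in>K. 0 \<le> \<beta> a \<and> \<beta> a \<le> 1)
    \<and> (\<forall>\<beta>\<in>K - U. \<beta> a \<le> r)"
proof -
  have KX: "K \<subseteq> character_space" using compactin_subset_topspace[OF K] by simp
  obtain F \<epsilon> where F: "finite F" "0 < \<epsilon>"
    "{\<beta> \<in> character_space. \<forall>a\<in>F. \<bar>\<beta> a - \<alpha> a\<bar> < \<epsilon>} \<subseteq> U"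
    using character_neighbourhood_basis[OF U] by blast
  define b where "b = (\<Sum>x\<in>F. (x - \<alpha> x *\<^sub>R 1)\<^sup>2)"
  have b: "\<beta> b = (\<Sum>x\<in>F. (\<beta> x - \<alpha> x)\<^sup>2)" if "\<beta> \<in> character_space" for \<beta>
    using character_linear[OF that]
    by (simp add: b_def linear_sum linear_diff linear_cmul character_power[OF that]
        character_one[OF that])
  have "compact ((\<lambda>\<beta>. \<beta> b) ` K)"
    using image_compactin[OF K continuous_map_evaluation[of b]] by simp
  then obtain B where B: "\<And>\<beta>. \<beta> \<in> K \<Longrightarrow> \<bar>\<beta> b\<bar> \<le> B"
    using compact_imp_bounded bounded_real by (metis image_eqI)
  \<comment> \<open>\<open>B\<close> keeps \<open>a\<close> nonnegative on \<open>K\<close>. The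
    second entry makes \<open>M\<close> positive even if \<open>b\<close> vanishes on
    \<open>K\<close>, and makes \<open>1 - \<epsilon>^2 / M\<close> nonnegative.\<close>
  define M where "M = max B (\<epsilon>\<^sup>2)"
  have M: "M > 0" "\<epsilon>\<^sup>2 \<le> M" using F(2) by (auto simp: M_def less_max_iff_disj)
  have bM: "0 \<le> \<beta> b \<and> \<beta> b \<le> M" if "\<beta> \<in> K" for \<beta>
    using B[OF that] b[of \<beta>] that KX by (auto simp: M_def sum_nonneg)
  define a where "a = 1 - (1 / M) *\<^sub>R b"
  have a: "\<beta> a = 1 - \<beta> b / M" if "\<beta> \<in> character_space" for \<beta>
    using character_linear[OF that]
    by (simp add: a_def linear_diff linear_cmul character_one[OF that])
  show ?thesis
  proof (intro exI[of _ a] exI[of _ "1 - \<epsilon>\<^sup>2 / M"] conjI ballI)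
    show "0 \<le> 1 - \<epsilon>\<^sup>2 / M" "1 - \<epsilon>\<^sup>2 / M < 1" using M F(2) by (auto simp: field_simps)
    show "\<alpha> a = 1" using a[of \<alpha>] b[of \<alpha>] \<alpha> KX by auto
    show "0 \<le> \<beta> a" "\<beta> a \<le> 1" if "\<beta> \<in> K" for \<beta>
    proof -
      have "\<beta> a = 1 - \<beta> b / M" using a that KX by blast
      moreover have "0 \<le> \<beta> b / M" "\<beta> b / M \<le> 1" using bM[OF that] M by simp_all
      ultimately show "0 \<le> \<beta> a" "\<beta> a \<le> 1" by simp_all
    qed
    show "\<beta> a \<le> 1 - \<epsilon>\<^sup>2 / M" if KU: "\<beta> \<in> K - U" for \<beta>
    proof -
      have \<beta>: "\<beta> \<in> character_space" using KU KX by blast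
      then obtain x where x: "x \<in> F" "\<epsilon> \<le> \<bar>\<beta> x - \<alpha> x\<bar>"
        using KU F(3) by (fastforce simp: not_less)
      have "\<epsilon>\<^sup>2 \<le> (\<beta> x - \<alpha> x)\<^sup>2" using x(2) F(2) by (simp add: abs_le_square_iff[symmetric])
      also have "\<dots> \<le> \<beta> b"
        unfolding b[OF \<beta>] by (rule member_le_sum[OF x(1)]) (use F in auto)
      finally show ?thesis using a[OF \<beta>] M(1) by (simp add: divide_right_mono)
    qed
  qed
qed

section \<open>The representing measure, its support and its point masses\<close>

text \<open>Evaluation at \<open>1\<close> is the constant function \<open>1\<close> on the space,
  so its integrability gives finiteness and its integral gives the total mass.\<close>

lemma prob_space_represented_by:
  assumes "radon_measure character_topology \<nu>" "represented_by L \<nu>" "L 1 = 1"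
  shows "prob_space \<nu>"
proof
  have sp: "space \<nu> = character_space" using assms(1) by (simp add: radon_measure_def)
  have "integrable \<nu> (\<lambda>\<alpha>. \<alpha> 1)" "L 1 = (\<integral>\<alpha>. \<alpha> 1 \<partial>\<nu>)"
    using assms(2) by (auto simp: represented_by_def)
  moreover have "integrable \<nu> (\<lambda>\<alpha>. \<alpha> 1) \<longleftrightarrow> integrable \<nu> (\<lambda>\<alpha>. 1::real)"
    by (rule Bochner_Integration.integrable_cong) (simp_all add: sp character_one)
  moreover have "(\<integral>\<alpha>. \<alpha> 1 \<partial>\<nu>) = (\<integral>\<alpha>. 1 \<partial>\<nu>)"
    by (rule Bochner_Integration.integral_cong) (simp_all add: sp character_one)
  ultimately have "integrable \<nu> (\<lambda>\<alpha>. 1::real)" "(\<integral>\<alpha>. 1 \<partial>\<nu>) = (1::real)"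
    using assms(3) by simp_all
  then show "emeasure \<nu> (space \<nu>) = 1"
    by (simp add: integrable_iff_bounded emeasure_eq_ennreal_measure less_top)
qed

lemma AE_measure_support:
  assumes "radon_measure T \<nu>" "is_measure_support T \<nu> K"
  shows "AE x in \<nu>. x \<in> K"
proof (rule AE_I)
  have "openin T (topspace T - K)" using assms(2) by (auto simp: is_measure_support_def)
  then show "topspace T - K \<in> sets \<nu>" using assms(1) by (auto simp: radon_measure_def)
qed (use assms in \<open>auto simp: radon_measure_def is_measure_support_def\<close>)

text \<open>If \<open>V\<close> were null, its complement would be a closed set of full measure,
  hence would contain \<open>K\<close> by minimality, although \<open>x\<close> lies in both
  \<open>K\<close> and \<open>V\<close>.\<close>

lemma open_meets_measure_support:
  assumes "is_measure_support T \<nu> K" "openin T V" "x \<in> K" "x \<in> V"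
  shows "emeasure \<nu> V \<noteq> 0"
proof
  assume "emeasure \<nu> V = 0"
  moreover have "topspace T - (topspace T - V) = V" using openin_subset[OF assms(2)] by blast
  ultimately have "K \<subseteq> topspace T - V"
    using assms(1,2) unfolding is_measure_support_def by (metis closedin_diff closedin_topspace)
  then show False using assms by blast
qed

text \<open>Inner regularity is applied to the complement of \<open>x\<close>. A compact set
  avoiding \<open>x\<close> is closed, so its complement is a neighbourhood of mass at least
  \<open>c\<close>, and the compact set has mass at most \<open>1 - c\<close>.\<close>

lemma radon_measure_singleton_ge:
  assumes R: "radon_measure T \<nu>" and "prob_space \<nu>" and H: "Hausdorff_space T"
    and x: "x \<in> topspace T"
    and c: "\<And>U. openin T U \<Longrightarrow> x \<in> U \<Longrightarrow> c \<le> measure \<nu> U"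
  shows "c \<le> measure \<nu> {x}"
proof -
  interpret prob_space \<nu> by fact
  have sp: "space \<nu> = topspace T" using R by (simp add: radon_measure_def)
  have op: "U \<in> sets \<nu>" if "openin T U" for U using R that by (auto simp: radon_measure_def)
  have o: "openin T (topspace T - {x})"
    using closedin_Hausdorff_sing_eq[OF H] x by blast
  have m: "{x} \<in> sets \<nu>"
  proof -
    have "space \<nu> - (topspace T - {x}) = {x}" using x sp by blast
    then show ?thesis by (metis op[OF o] sets.compl_sets)
  qed
  have "emeasure \<nu> (topspace T - {x}) \<le> ennreal (1 - c)"
  proof -
    have "emeasure \<nu> C \<le> ennreal (1 - c)"
      if "compactin T C" "C \<in> sets \<nu>" "C \<subseteq> topspace T - {x}" for C
    proof -
      have "closedin T C" using compactin_imp_closedin[OF H that(1)] .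
      then have "c \<le> prob (space \<nu> - C)" using c[of "topspace T - C"] x that sp by auto
      then have "prob C \<le> 1 - c" using prob_compl[OF that(2)] by simp
      then show ?thesis by (simp add: emeasure_eq_measure ennreal_leI)
    qed
    then have "(SUP C\<in>{C. compactin T C \<and> C \<in> sets \<nu> \<and> C \<subseteq> topspace T - {x}}. emeasure \<nu> C)
        \<le> ennreal (1 - c)"
      by (intro SUP_least) blast
    moreover have "emeasure \<nu> (topspace T - {x}) =
        (SUP C\<in>{C. compactin T C \<and> C \<in> sets \<nu> \<and> C \<subseteq> topspace T - {x}}. emeasure \<nu> C)"
      using R op[OF o] unfolding radon_measure_def by blast
    ultimately show ?thesis by (rule ord_eq_le_trans[rotated])
  qed
  \<comment> \<open>\<open>ennreal\<close> sends negative reals to \<open>0\<close>, so the sign of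
    \<open>1 - c\<close> must be known before the bound returns to the reals. The whole space serves
    as the neighbourhood.\<close>
  moreover have "0 \<le> 1 - c" using c[of "topspace T"] x prob_space sp by simp
  ultimately have "prob (space \<nu> - {x}) \<le> 1 - c"
    by (simp add: emeasure_eq_measure sp)
  then show ?thesis using prob_compl[OF m] by simp
qed

section \<open>Integrals of powers and the lower bound for neighbourhoods\<close>

lemma integral_power_element:
  assumes "radon_measure character_topology \<nu>" "represented_by L \<nu>"
  shows "integrable \<nu> (\<lambda>\<beta>. \<beta> a ^ n)" "L (a ^ n) = (\<integral>\<beta>. \<beta> a ^ n \<partial>\<nu>)"
proof -
  have sp: "space \<nu> = character_space" using assms(1) by (simp add: radon_measure_def)
  have *: "integrable \<nu> (\<lambda>\<beta>. \<beta> (a ^ n))" "L (a ^ n) = (\<integral>\<beta>. \<beta> (a ^ n) \<partial>\<nu>)"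
    using assms(2) by (auto simp: represented_by_def)
  show "integrable \<nu> (\<lambda>\<beta>. \<beta> a ^ n)"
    by (rule iffD1[OF Bochner_Integration.integrable_cong[OF refl] *(1)])
      (simp add: sp character_power)
  show "L (a ^ n) = (\<integral>\<beta>. \<beta> a ^ n \<partial>\<nu>)"
    unfolding *(2) using sp by (intro Bochner_Integration.integral_cong) (auto simp: character_power)
qed

text \<open>If the supremum were some \<open>s < 1\<close>, the even moments of \<open>a\<close>
  would decay at least like \<open>s ^ (2 * n)\<close>. But \<open>a\<close> exceeds any
  \<open>t\<close> with \<open>s < t < 1\<close> on a neighbourhood of \<alpha>, which has positive
  mass because \<alpha> is in the support.\<close>

lemma p_sup_ge_1:
  fixes L :: "'a::{real_algebra_1,comm_ring_1} \<Rightarrow> real"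
  assumes R: "radon_measure character_topology \<nu>" and rep: "represented_by L \<nu>" and L1: "L 1 = 1"
    and S: "is_measure_support character_topology \<nu> K" and \<alpha>: "\<alpha> \<in> K"
    and a: "\<alpha> a = 1" "\<And>\<beta>. \<beta> \<in> K \<Longrightarrow> 0 \<le> \<beta> a \<and> \<beta> a \<le> 1"
  shows "1 \<le> p_sup L a"
proof (rule ccontr)
  assume less: "\<not> 1 \<le> p_sup L a"
  interpret prob_space \<nu> using prob_space_represented_by[OF R rep L1] .
  note int = integral_power_element[OF R rep]
  have aeK: "AE \<beta> in \<nu>. 0 \<le> \<beta> a \<and> \<beta> a \<le> 1"
    using AE_measure_support[OF R S] by eventually_elim (use a in auto)
  have L01: "0 \<le> L (a ^ n)" "L (a ^ n) \<le> 1" for n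
  proof -
    have "AE \<beta> in \<nu>. 0 \<le> \<beta> a ^ n"
      using aeK by eventually_elim simp
    then show "0 \<le> L (a ^ n)" unfolding int(2) by (rule integral_nonneg_AE)
    have "AE \<beta> in \<nu>. \<beta> a ^ n \<le> 1"
      using aeK by eventually_elim (simp add: power_le_one)
    then have "(\<integral>\<beta>. \<beta> a ^ n \<partial>\<nu>) \<le> (\<integral>\<beta>. 1 \<partial>\<nu>)"
      by (intro integral_mono_AE int) simp_all
    then show "L (a ^ n) \<le> 1" unfolding int(2) by (simp add: prob_space)
  qed
  \<comment> \<open>Boundedness must be shown before a member of the family can be compared with its
    real supremum.\<close>
  have bdd: "bdd_above ((\<lambda>n. root (2 * n) (L (a ^ (2 * n)))) ` {1..})"
  proof (rule bdd_aboveI2)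
    fix n :: nat assume "n \<in> {1..}"
    then show "root (2 * n) (L (a ^ (2 * n))) \<le> 1"
      using L01(2)[of "2 * n"] by (simp add: real_root_le_1_iff)
  qed
  define s where "s = p_sup L a"
  have root_le: "root (2 * n) (L (a ^ (2 * n))) \<le> s" if "n \<ge> 1" for n
    unfolding s_def p_sup_def by (rule cSUP_upper[OF _ bdd]) (use that in auto)
  have s0: "0 \<le> s"
    using root_le[of 1] L01(1)[of 2] by (simp add: order_trans[OF real_root_ge_zero])
  have s1: "s < 1" using less by (simp add: s_def)
  have L_le: "L (a ^ (2 * n)) \<le> s ^ (2 * n)" if "n \<ge> 1" for n
  proof -
    have "L (a ^ (2 * n)) = root (2 * n) (L (a ^ (2 * n))) ^ (2 * n)"
      using that L01(1) by simp
    also have "\<dots> \<le> s ^ (2 * n)"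
      by (rule power_mono[OF root_le[OF that]]) (use L01 in \<open>simp add: real_root_ge_zero\<close>)
    finally show ?thesis .
  qed
  \<comment> \<open>\<open>t < 1\<close> puts \<alpha> into \<open>V\<close>; \<open>s < t\<close>
    makes the powers of \<open>(s / t)^2\<close> tend to zero.\<close>
  define t where "t = (s + 1) / 2"
  have t: "s < t" "t < 1" "0 < t" using s0 s1 by (auto simp: t_def)
  define V where "V = {\<beta> \<in> character_space. t < \<beta> a}"
  have V: "openin character_topology V"
    using openin_continuous_map_preimage[OF continuous_map_evaluation[of a], of "{t<..}"]
    by (simp add: V_def)
  have Vm: "V \<in> sets \<nu>" using V R by (auto simp: radon_measure_def)
  have "\<alpha> \<in> character_space"
    using S \<alpha> closedin_subset unfolding is_measure_support_def by fastforce
  then have "emeasure \<nu> V \<noteq> 0"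
    using open_meets_measure_support[OF S V \<alpha>] a(1) t by (simp add: V_def)
  then have Vpos: "0 < prob V" by (simp add: emeasure_eq_measure zero_less_measure_iff)
  have le: "prob V \<le> ((s / t)\<^sup>2) ^ n" if "n \<ge> 1" for n
  proof -
    \<comment> \<open>Markov's inequality for the power \<open>2 * n\<close>.\<close>
    have "t ^ (2 * n) * prob V = (\<integral>\<beta>. t ^ (2 * n) * indicator V \<beta> \<partial>\<nu>)"
      using Vm by simp
    also have "\<dots> \<le> (\<integral>\<beta>. \<beta> a ^ (2 * n) \<partial>\<nu>)"
    proof (rule integral_mono_AE)
      show "AE \<beta> in \<nu>. t ^ (2 * n) * indicator V \<beta> \<le> \<beta> a ^ (2 * n)"
        using aeK
        by eventually_elim (use t in \<open>auto simp: indicator_def V_def intro!: power_mono\<close>)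
    qed (use int Vm in \<open>auto simp: emeasure_eq_measure\<close>)
    also have "\<dots> \<le> s ^ (2 * n)" using L_le[OF that] by (simp add: int(2))
    finally show ?thesis using t by (simp add: field_simps power_mult[symmetric])
  qed
  have "(\<lambda>n. ((s / t)\<^sup>2) ^ n) \<longlonglongrightarrow> 0"
    by (rule LIMSEQ_power_zero) (use t s0 in \<open>simp add: abs_square_less_1\<close>)
  then have "prob V \<le> 0"
    by (rule LIMSEQ_le_const) (use le in blast)
  then show False using Vpos by simp
qed

text \<open>The bound is attained at \<alpha>, so the supremum is a maximum, which also settles its
  boundedness.\<close>

lemma peak_setI:
  assumes "\<alpha> \<in> K" "\<And>\<beta>. \<beta> \<in> K \<Longrightarrow> \<bar>\<beta> a\<bar> \<le> \<bar>\<alpha> a\<bar>"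
  shows "a \<in> peak_set K \<alpha>"
  unfolding peak_set_def sup_on_def using assms
  by (auto intro!: cSup_eq_maximum)

text \<open>\<open>C\<close> and \<open>d\<close> are fixed before \<open>U\<close>, so the same
  lower bound serves every neighbourhood and can be passed to
  \<open>radon_measure_singleton_ge\<close>.\<close>

lemma measure_neighbourhood_ge:
  fixes L :: "'a::{real_algebra_1,comm_ring_1} \<Rightarrow> real"
  assumes R: "radon_measure character_topology \<nu>" and rep: "represented_by L \<nu>" and L1: "L 1 = 1"
    and S: "is_measure_support character_topology \<nu> K"
    and K: "compactin character_topology K" and \<alpha>: "\<alpha> \<in> K"
    and C: "0 < C" "\<And>a. a \<in> peak_set K \<alpha> \<Longrightarrow> C * p_sup L a \<le> p_dyadic L d a"
    and U: "openin character_topology U" "\<alpha> \<in> U"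
  shows "C ^ (2 ^ d) \<le> measure \<nu> U"
proof -
  interpret prob_space \<nu> using prob_space_represented_by[OF R rep L1] .
  note int = integral_power_element[OF R rep]
  have KX: "K \<subseteq> character_space" using compactin_subset_topspace[OF K] by simp
  have Um: "U \<in> sets \<nu>" using U R by (auto simp: radon_measure_def)
  obtain a r where r: "0 \<le> r" "r < 1" and a: "\<alpha> a = 1"
    "\<And>\<beta>. \<beta> \<in> K \<Longrightarrow> 0 \<le> \<beta> a \<and> \<beta> a \<le> 1" "\<And>\<beta>. \<beta> \<in> K - U \<Longrightarrow> \<beta> a \<le> r"
    using exists_peaking_element[OF K \<alpha> U] by auto
  have le: "C ^ (2 ^ d) \<le> prob U + (r ^ (2 ^ d)) ^ n" for n
  proof -
    have pw: "\<beta> (a ^ n) = \<beta> a ^ n" if "\<beta> \<in> K" for \<beta>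
      using that KX character_power by blast
    have an: "\<alpha> (a ^ n) = 1" "\<And>\<beta>. \<beta> \<in> K \<Longrightarrow> 0 \<le> \<beta> (a ^ n) \<and> \<beta> (a ^ n) \<le> 1"
      by (simp_all add: pw \<alpha> a(1) a(2) power_le_one)
    have "a ^ n \<in> peak_set K \<alpha>" by (rule peak_setI[OF \<alpha>]) (use an in auto)
    then have "C * p_sup L (a ^ n) \<le> p_dyadic L d (a ^ n)" by (rule C(2))
    moreover have "1 \<le> p_sup L (a ^ n)" using p_sup_ge_1[OF R rep L1 S \<alpha>, of "a ^ n"] an by simp
    ultimately have "C \<le> p_dyadic L d (a ^ n)"
      using mult_left_mono[of 1 "p_sup L (a ^ n)" C] C(1) by linarith
    then have Cr: "C \<le> root (2 ^ d) (L ((a ^ n) ^ (2 ^ d)))" by (simp add: p_dyadic_def)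
    \<comment> \<open>\<open>root\<close> is extended oddly to negative arguments. Positivity of the
      root therefore forces a positive argument, after which the power cancels the root.\<close>
    then have "0 < root (2 ^ d) (L ((a ^ n) ^ (2 ^ d)))" using C(1) by (rule less_le_trans[rotated])
    then have "0 < L ((a ^ n) ^ (2 ^ d))"
      using real_root_gt_0_iff[of "2 ^ d" "L ((a ^ n) ^ (2 ^ d))"] by simp
    then have "C ^ (2 ^ d) \<le> L ((a ^ n) ^ (2 ^ d))"
      using power_mono[OF Cr, of "2 ^ d"] C(1) by simp
    also have "\<dots> = L (a ^ (2 ^ d * n))" by (simp add: power_mult[symmetric] mult.commute)
    also have "\<dots> = (\<integral>\<beta>. \<beta> a ^ (2 ^ d * n) \<partial>\<nu>)" by (rule int)
    \<comment> \<open>Almost every point lies in \<open>K\<close>; there the integrand is at most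
      \<open>1\<close> on \<open>U\<close> and at most \<open>r ^ (2 ^ d * n)\<close> off
      \<open>U\<close>.\<close>
    also have "\<dots> \<le> (\<integral>\<beta>. indicator U \<beta> + r ^ (2 ^ d * n) \<partial>\<nu>)"
    proof (rule integral_mono_AE)
      show "AE \<beta> in \<nu>. \<beta> a ^ (2 ^ d * n) \<le> indicator U \<beta> + r ^ (2 ^ d * n)"
        using AE_measure_support[OF R S]
      proof eventually_elim
        fix \<beta> assume \<beta>: "\<beta> \<in> K"
        show "\<beta> a ^ (2 ^ d * n) \<le> indicator U \<beta> + r ^ (2 ^ d * n)"
        proof (cases "\<beta> \<in> U")
          case True
          then show ?thesis
            using a(2)[OF \<beta>] r by (simp add: power_le_one add_increasing2)
        next
          case False
          then show ?thesis
            using a(2)[OF \<beta>] a(3)[of \<beta>] \<beta> by (auto intro: power_mono)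
        qed
      qed
    qed (use int Um in \<open>auto simp: emeasure_eq_measure\<close>)
    also have "\<dots> = prob U + r ^ (2 ^ d * n)"
      using Um by (subst Bochner_Integration.integral_add) (auto simp: emeasure_eq_measure prob_space)
    finally show ?thesis by (simp add: power_mult)
  qed
  have "r ^ (2 ^ d) < 1" using r by (simp add: power_less_one_iff)
  then have "(\<lambda>n. (r ^ (2 ^ d)) ^ n) \<longlonglongrightarrow> 0"
    using r(1) by (intro LIMSEQ_realpow_zero) simp_all
  then have "(\<lambda>n. prob U + (r ^ (2 ^ d)) ^ n) \<longlonglongrightarrow> prob U + 0"
    by (rule tendsto_add[OF tendsto_const])
  then have "C ^ (2 ^ d) \<le> prob U + 0"
    by (rule LIMSEQ_le_const) (use le in blast)
  then show ?thesis by simp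
qed

theorem corollary3p14:
  fixes L :: "'a::{real_algebra_1,comm_ring_1} \<Rightarrow> real"
    and \<nu> :: "('a \<Rightarrow> real) measure"
    and K :: "('a \<Rightarrow> real) set"
  assumes "(character_space :: ('a \<Rightarrow> real) set) \<noteq> {}"
    and "linear L"
    and "L 1 = 1"
    and "radon_measure character_topology \<nu>"
    and "represented_by L \<nu>"
    and "is_measure_support character_topology \<nu> K"
    and "compactin character_topology K"
    and "\<forall>\<alpha>\<in>K. \<exists>C d. 0 < C \<and> C \<le> 1 \<and> 1 \<le> d \<and>
           (\<forall>a\<in>peak_set K \<alpha>. C * p_sup L a \<le> p_dyadic L d a)"
  shows "countable K"
proof -
  have prob: "prob_space \<nu>" using prob_space_represented_by assms(3-5) by blast
  then interpret prob_space \<nu> .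
  have "measure \<nu> {\<alpha>} \<noteq> 0" if \<alpha>: "\<alpha> \<in> K" for \<alpha>
  proof -
    obtain C d where C: "0 < C" "\<And>a. a \<in> peak_set K \<alpha> \<Longrightarrow> C * p_sup L a \<le> p_dyadic L d a"
      using assms(8) \<alpha> by blast
    have "\<alpha> \<in> topspace character_topology"
      using compactin_subset_topspace[OF assms(7)] \<alpha> by blast
    then have "C ^ (2 ^ d) \<le> measure \<nu> {\<alpha>}"
      by (rule radon_measure_singleton_ge[OF assms(4) prob Hausdorff_character_topology])
        (rule measure_neighbourhood_ge[OF assms(4,5,3,6,7) \<alpha> C])
    moreover have "0 < C ^ (2 ^ d)" using C(1) by simp
    ultimately show ?thesis by linarith
  qed
  then have "K \<subseteq> {\<alpha>. measure \<nu> {\<alpha>} \<noteq> 0}" by blast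
  then show ?thesis by (rule countable_subset) (rule countable_support)
qed

end
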